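(* Let $(C,e,\lambda,\oplus)$ be the free Catalan structure, let $h\colon C\to C$ be the map defined in the context, and let $\mathrm{leaves},\mathrm{internal},\mathrm{sub},\mathrm{rpath}\colon C\to\mathbb{Z}_{\ge 0}$ be the four canonical statistics. For all $t\in C$ with $|t|\ge 1$, $$\mathrm{rpath}(h(t))=\mathrm{sub}(t)\quad\text{and}\quad \mathrm{leaves}(h(t))=\mathrm{internal}(t).$$ In particular, for every $n\ge 1$, the pairs $(\mathrm{sub},\mathrm{leaves})$ and $(\mathrm{rpath},\mathrm{internal})$ have the same joint distribution on $C_n$.
   Context: A Catalan structure is a quadruple $(C,e,\lambda,\oplus)$ where $C=\bigsqcup_{n\ge 0}C_n$ with $C_0=\{e\}$ (write $|t|=n$ for $t\in C_n$), $\lambda\colon C_n\to C_{n+1}$, $\oplus\colon C_m\times C_n\to C_{m+n}$, the operation $\oplus$ is associative with two-sided identity $e$, and every $t\in C$ can be written uniquely in exactly one of three forms: $t=e$; $t=\lambda(s)$ with $s\in C$ (indecomposable); $t=u\oplus v$ with $u$ indecomposable and $v\in C\setminus C_0$ (decomposable). Hence every nonempty $t$ is uniquely $\lambda(u)\oplus v$ (first-return decomposition, $v=e$ allowed). The free Catalan structure is the set of formal expressions $e$, $\lambda(t)$, and $\lambda(u)\oplus v$ with $v\ne e$, with the evident operations; it is isomorphic to rooted plane trees written as lists of children, with $e=[\,]$, $\lambda(T)=[T]$, $\oplus$ = concatenation of child lists, and size = number of edges. Derived operations: $\gamma(t)=t\oplus\lambda(e)$, and $\ominus$ is defined by $e\ominus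 v=v$, $\lambda(u)\ominus v=\lambda(u\ominus v)$, $(t\oplus u)\ominus v=t\oplus(u\ominus v)$ for $t,u\neq e$ (well defined; one may take $t$ indecomposable). The map $h$: $h(e)=e$ and $h(\lambda(u)\oplus v)=h(v)\ominus\gamma(h(u))$. Canonical statistics (in each clause for $u\oplus v$ both $u,v\ne e$): $\mathrm{leaves}(e)=1$, $\mathrm{leaves}(\lambda(t))=\mathrm{leaves}(t)$, $\mathrm{leaves}(u\oplus v)=\mathrm{leaves}(u)+\mathrm{leaves}(v)$; $\mathrm{internal}(e)=0$, $\mathrm{internal}(\lambda(t))=1+\mathrm{internal}(t)$, $\mathrm{internal}(u\oplus v)=\mathrm{internal}(u)+\mathrm{internal}(v)-1$; $\mathrm{sub}(e)=0$, $\mathrm{sub}(\lambda(t))=1$, $\mathrm{sub}(u\oplus v)=\mathrm{sub}(u)+\mathrm{sub}(v)$; $\mathrm{rpath}(e)=0$, $\mathrm{rpath}(\lambda(t))=1+\mathrm{rpath}(t)$, $\mathrm{rpath}(u\oplus v)=\mathrm{rpath}(v)$. *)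

theory Defs
  imports Main
begin

text \<open>
  A Catalan structure. The sets C_n of the grading are the level sets of the function \<open>sz\<close>.
  The three forms in which an element can be written exclude each other, and each of them
  determines its constituents.
\<close>

locale catalan_structure =
  fixes e :: 'a
    and lam :: "'a \<Rightarrow> 'a"
    and oplus :: "'a \<Rightarrow> 'a \<Rightarrow> 'a"  (infixr "\<oplus>" 65)
    and sz :: "'a \<Rightarrow> nat"
  assumes sz_zero: "sz t = 0 \<longleftrightarrow> t = e"
    and sz_lam: "sz (lam t) = Suc (sz t)"
    and sz_oplus: "sz (u \<oplus> v) = sz u + sz v"
    and assoc: "(t \<oplus> u) \<oplus> v = t \<oplus> (u \<oplus> v)"
    and left_id: "e \<oplus> t = t"
    and right_id: "t \<oplus> e = t"
    and form_exists: "t = e \<or> (\<exists>s. t = lam s) \<or> (\<exists>u v. v \<noteq> e \<and> t = lam u \<oplus> v)"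
    and e_not_lam: "e \<noteq> lam s"
    and e_not_oplus: "v \<noteq> e \<Longrightarrow> e \<noteq> lam u \<oplus> v"
    and lam_not_oplus: "v \<noteq> e \<Longrightarrow> lam s \<noteq> lam u \<oplus> v"
    and lam_unique: "lam s = lam s' \<Longrightarrow> s = s'"
    and oplus_unique: "v \<noteq> e \<Longrightarrow> v' \<noteq> e \<Longrightarrow> lam u \<oplus> v = lam u' \<oplus> v' \<Longrightarrow> lam u = lam u' \<and> v = v'"

text \<open>
  The free Catalan structure. \<open>FR u v\<close> is the first-return expression \<open>\<lambda>(u) \<oplus> v\<close>, with
  \<open>v = E\<close> allowed: \<open>FR u E\<close> is the formal expression \<open>\<lambda>(u)\<close>, and \<open>FR u v\<close> with \<open>v \<noteq> E\<close> is
  the formal expression \<open>\<lambda>(u) \<oplus> v\<close>.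
\<close>

datatype cat = E | FR cat cat

definition lam :: "cat \<Rightarrow> cat" where
  "lam t = FR t E"

primrec oplus :: "cat \<Rightarrow> cat \<Rightarrow> cat"  (infixr "\<oplus>" 65) where
  "E \<oplus> v = v"
| "FR u w \<oplus> v = FR u (w \<oplus> v)"

primrec csize :: "cat \<Rightarrow> nat" where
  "csize E = 0"
| "csize (FR u v) = Suc (csize u) + csize v"

definition Cn :: "nat \<Rightarrow> cat set" where
  "Cn n = {t. csize t = n}"

definition gam :: "cat \<Rightarrow> cat" where
  "gam t = t \<oplus> lam E"

primrec ominus :: "cat \<Rightarrow> cat \<Rightarrow> cat"  (infixr "\<ominus>" 65) where
  "E \<ominus> v = v"
| "FR u w \<ominus> v = (if w = E then lam (u \<ominus> v) else lam u \<oplus> (w \<ominus> v))"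

primrec hmap :: "cat \<Rightarrow> cat" where
  "hmap E = E"
| "hmap (FR u v) = hmap v \<ominus> gam (hmap u)"

primrec leaves :: "cat \<Rightarrow> nat" where
  "leaves E = 1"
| "leaves (FR u v) = (if v = E then leaves u else leaves u + leaves v)"

text \<open>
  The subtraction does not truncate: already the first summand \<open>1 + internal u\<close>, which is
  the value at \<open>\<lambda>(u)\<close>, is positive.
\<close>

primrec internal :: "cat \<Rightarrow> nat" where
  "internal E = 0"
| "internal (FR u v) =
    (if v = E then 1 + internal u else (1 + internal u) + internal v - 1)"

primrec subs :: "cat \<Rightarrow> nat" where
  "subs E = 0"
| "subs (FR u v) = (if v = E then 1 else 1 + subs v)"

primrec rpath :: "cat \<Rightarrow> nat" where
  "rpath E = 0"
| "rpath (FR u v) = (if v = E then 1 + rpath u else rpath v)"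

text \<open>
  The remaining facts show that the recursions above satisfy the defining clauses for
  arbitrary decompositions \<open>u \<oplus> v\<close>, that \<open>cat\<close> is a Catalan structure, and that its
  levels are finite (so that cardinalities of their subsets are meaningful).
\<close>

lemma FR_eq: "FR u v = lam u \<oplus> v"
  by (simp add: lam_def)

lemma oplus_E [simp]: "t \<oplus> E = t"
  by (induction t) auto

lemma oplus_assoc: "(t \<oplus> u) \<oplus> v = t \<oplus> (u \<oplus> v)"
  by (induction t) auto

lemma oplus_eq_E [simp]: "u \<oplus> v = E \<longleftrightarrow> u = E \<and> v = E"
  by (cases u) auto

lemma csize_oplus: "csize (u \<oplus> v) = csize u + csize v"
  by (induction u) auto

lemma csize_eq_0: "csize t = 0 \<longleftrightarrow> t = E"
  by (cases t) auto

lemma cat_catalan_structure: "catalan_structure E lam (\<oplus>) csize"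
proof
  fix t :: cat
  show "t = E \<or> (\<exists>s. t = lam s) \<or> (\<exists>u v. v \<noteq> E \<and> t = lam u \<oplus> v)"
    by (cases t) (auto simp: lam_def)
qed (auto simp: csize_eq_0 csize_oplus oplus_assoc lam_def)

lemma ominus_clauses:
  "E \<ominus> v = v"
  "lam u \<ominus> v = lam (u \<ominus> v)"
  "t \<noteq> E \<Longrightarrow> u \<noteq> E \<Longrightarrow> (t \<oplus> u) \<ominus> v = t \<oplus> (u \<ominus> v)"
proof -
  show "t \<noteq> E \<Longrightarrow> u \<noteq> E \<Longrightarrow> (t \<oplus> u) \<ominus> v = t \<oplus> (u \<ominus> v)"
  proof (induction t)
    case (FR a b)
    then show ?case by (cases "b = E") (auto simp: lam_def)
  qed simp
qed (auto simp: lam_def)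

lemma hmap_clauses:
  "hmap E = E"
  "hmap (lam u \<oplus> v) = hmap v \<ominus> gam (hmap u)"
  by (auto simp: lam_def)

lemma leaves_clauses:
  "leaves E = 1"
  "leaves (lam t) = leaves t"
  "u \<noteq> E \<Longrightarrow> v \<noteq> E \<Longrightarrow> leaves (u \<oplus> v) = leaves u + leaves v"
  by (induction u) (auto simp: lam_def)

lemma internal_pos: "t \<noteq> E \<Longrightarrow> internal t \<ge> 1"
  by (induction t) auto

lemma internal_clauses:
  "internal E = 0"
  "internal (lam t) = 1 + internal t"
  "u \<noteq> E \<Longrightarrow> v \<noteq> E \<Longrightarrow> internal (u \<oplus> v) = internal u + internal v - 1"
proof -
  show "u \<noteq> E \<Longrightarrow> v \<noteq> E \<Longrightarrow> internal (u \<oplus> v) = internal u + internal v - 1"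
  proof (induction u)
    case (FR a b)
    then show ?case using internal_pos[of b] by (cases "b = E") auto
  qed simp
qed (auto simp: lam_def)

lemma subs_clauses:
  "subs E = 0"
  "subs (lam t) = 1"
  "u \<noteq> E \<Longrightarrow> v \<noteq> E \<Longrightarrow> subs (u \<oplus> v) = subs u + subs v"
  by (induction u) (auto simp: lam_def)

lemma rpath_clauses:
  "rpath E = 0"
  "rpath (lam t) = 1 + rpath t"
  "u \<noteq> E \<Longrightarrow> v \<noteq> E \<Longrightarrow> rpath (u \<oplus> v) = rpath v"
proof -
  show "u \<noteq> E \<Longrightarrow> v \<noteq> E \<Longrightarrow> rpath (u \<oplus> v) = rpath v"
  proof (induction u)
    case (FR a b)
    then show ?case by (cases "b = E") auto
  qed simp
qed (auto simp: lam_def)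

lemma finite_csize_le: "finite {t. csize t \<le> n}"
proof (induction n)
  case 0
  then show ?case by (simp add: csize_eq_0)
next
  case (Suc n)
  have "{t. csize t \<le> Suc n} \<subseteq>
      insert E (case_prod FR ` ({t. csize t \<le> n} \<times> {t. csize t \<le> n}))"
  proof
    fix t assume "t \<in> {t. csize t \<le> Suc n}"
    then show "t \<in> insert E (case_prod FR ` ({t. csize t \<le> n} \<times> {t. csize t \<le> n}))"
      by (cases t) (auto simp: image_iff)
  qed
  then show ?case using Suc by (auto intro: finite_subset)
qed

lemma finite_Cn: "finite (Cn n)"
  by (rule finite_subset[OF _ finite_csize_le[of n]]) (auto simp: Cn_def)

end

theory Submission
  imports Defs
begin

text \<open>
  The operation \<open>\<ominus>\<close> grafts its second argument at the rightmost leaf of the first, so it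
  adds \<open>rpath\<close>, and adds \<open>leaves\<close> up to the leaf that is lost. This gives the two identities
  for \<open>hmap\<close> by induction. Since \<open>gam x\<close> has right path length one, \<open>a \<ominus> gam x\<close> determines
  \<open>a\<close> and \<open>x\<close>; hence \<open>hmap\<close> is injective, and a bijection on each finite \<open>Cn n\<close>. It carries
  (subs, internal) to (rpath, leaves), and \<open>leaves + internal = csize + 1\<close> lets one exchange
  the second statistics.
\<close>

lemma E_eq_oplus: "E = u \<oplus> v \<longleftrightarrow> u = E \<and> v = E"
  by (metis oplus_eq_E)

lemma ominus_eq_E [simp]: "a \<ominus> v = E \<longleftrightarrow> a = E \<and> v = E"
  by (cases a) (auto simp: lam_def)

lemma gam_neq_E [simp]: "gam x \<noteq> E"
  by (simp add: gam_def lam_def)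

lemma rpath_gam [simp]: "rpath (gam x) = 1"
  by (induction x) (auto simp: gam_def lam_def)

text \<open>The new child of the root is a leaf, but at \<open>x = E\<close> the root itself stops
  being one.\<close>

lemma leaves_gam: "leaves (gam x) = (if x = E then 1 else leaves x + 1)"
  by (induction x) (auto simp: gam_def lam_def)

lemma csize_gam [simp]: "csize (gam x) = Suc (csize x)"
  by (simp add: gam_def csize_oplus lam_def)

lemma inj_gam: "gam x = gam y \<Longrightarrow> x = y"
proof (induction x arbitrary: y)
  case E
  then show ?case by (cases y) (auto simp: gam_def lam_def E_eq_oplus)
next
  case (FR u v)
  then show ?case by (cases y) (auto simp: gam_def lam_def E_eq_oplus)
qed

lemma rpath_ominus: "rpath (a \<ominus> v) = rpath a + rpath v"
  by (induction a) (auto simp: lam_def)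

lemma leaves_ominus: "leaves (a \<ominus> v) + 1 = leaves a + leaves v"
  by (induction a) (auto simp: lam_def)

lemma csize_ominus: "csize (a \<ominus> v) = csize a + csize v"
  by (induction a) (auto simp: lam_def)

lemma rpath_eq_0: "rpath t = 0 \<longleftrightarrow> t = E"
  by (induction t) auto

lemma ominus_gam_inj: "a \<ominus> gam x = b \<ominus> gam y \<Longrightarrow> a = b \<and> x = y"
proof (induction a arbitrary: b)
  case E
  \<comment> \<open>Right paths have length 1 on the left and \<open>rpath b + 1\<close> on the
    right.\<close>
  then have "rpath b = 0"
    by (metis add_cancel_left_left ominus.simps(1) rpath_gam rpath_ominus)
  with E show ?case by (auto simp: rpath_eq_0 dest: inj_gam)
next
  case (FR p q)
  then have "rpath b = rpath (FR p q)"
    by (metis add_right_cancel rpath_gam rpath_ominus)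
  then have "b \<noteq> E"
    using rpath_eq_0[of "FR p q"] by (metis cat.distinct(1) rpath.simps(1))
  then obtain r s where "b = FR r s" by (cases b) auto
  \<comment> \<open>Grafting keeps a nonempty tail nonempty, so \<open>q\<close> and
    \<open>s\<close> are both \<open>E\<close> or both not; the induction hypothesis applies to
    \<open>p\<close> or \<open>q\<close> accordingly.\<close>
  with FR show ?case by (auto simp: lam_def eq_commute[of E] split: if_splits)
qed

lemma hmap_eq_E [simp]: "hmap t = E \<longleftrightarrow> t = E"
  by (cases t) auto

lemma csize_hmap [simp]: "csize (hmap t) = csize t"
  by (induction t) (auto simp: csize_ominus)

lemma inj_hmap: "inj hmap"
proof (rule injI)
  fix t t' assume "hmap t = hmap t'"
  then show "t = t'"
  proof (induction t arbitrary: t')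
    case E
    then show ?case by (metis hmap.simps(1) hmap_eq_E)
  next
    case (FR u v)
    then show ?case by (cases t') (auto dest: ominus_gam_inj)
  qed
qed

lemma bij_betw_hmap: "bij_betw hmap (Cn n) (Cn n)"
proof -
  have "inj_on hmap (Cn n)" using inj_hmap by (rule inj_on_subset) simp
  moreover have "hmap ` Cn n \<subseteq> Cn n" by (auto simp: Cn_def)
  ultimately show ?thesis
    by (simp add: bij_betw_def endo_inj_surj finite_Cn)
qed

lemma rpath_hmap: "rpath (hmap t) = subs t"
  by (induction t) (auto simp: rpath_ominus)

lemma leaves_hmap: "t \<noteq> E \<Longrightarrow> leaves (hmap t) = internal t"
proof (induction t)
  case (FR u v)
  have "leaves (hmap (FR u v)) + 1 = leaves (hmap v) + leaves (gam (hmap u))"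
    by (simp add: leaves_ominus[simplified])
  \<comment> \<open>The induction hypotheses exclude \<open>E\<close>, where
    \<open>hmap E = E\<close> has one leaf but \<open>internal E = 0\<close>.\<close>
  with FR show ?case by (cases "u = E"; cases "v = E") (auto simp: leaves_gam)
qed simp

text \<open>Every vertex is a leaf or internal, and a tree has one more vertex than edges.\<close>

lemma leaves_plus_internal: "leaves t + internal t = csize t + 1"
  by (induction t) auto

theorem theorem4p1:
  shows "(\<forall>t :: cat. csize t \<ge> 1 \<longrightarrow>
            rpath (hmap t) = subs t \<and> leaves (hmap t) = internal t) \<and>
         (\<forall>n \<ge> 1. \<forall>a b :: nat.
            card {t \<in> Cn n. subs t = a \<and> leaves t = b} =
            card {t \<in> Cn n. rpath t = a \<and> internal t = b})"
proof (intro conjI allI impI)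
  fix t :: cat assume "csize t \<ge> 1"
  then have "t \<noteq> E" by auto
  then show "rpath (hmap t) = subs t" "leaves (hmap t) = internal t"
    by (simp_all add: rpath_hmap leaves_hmap)
next
  fix n a b :: nat assume n: "n \<ge> 1"
  let ?A = "{t \<in> Cn n. subs t = a \<and> leaves t = b}"
  let ?B = "{t \<in> Cn n. rpath t = a \<and> internal t = b}"
  have stats: "rpath (hmap t) = subs t \<and> internal (hmap t) = leaves t" if "t \<in> Cn n" for t
  proof -
    \<comment> \<open>At \<open>E\<close> the second equation fails: 0 against 1. Elsewhere it is
      the complement of \<open>leaves_hmap\<close>, as \<open>hmap\<close> preserves size.\<close>
    have "t \<noteq> E" using that n by (auto simp: Cn_def)
    then show ?thesis
      using leaves_plus_internal[of t] leaves_plus_internal[of "hmap t"]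
      by (simp add: rpath_hmap leaves_hmap)
  qed
  have "hmap ` ?A = {s \<in> hmap ` Cn n. rpath s = a \<and> internal s = b}"
    using stats by auto
  also have "hmap ` Cn n = Cn n" using bij_betw_hmap by (rule bij_betw_imp_surj_on)
  finally have "bij_betw hmap ?A ?B"
    by (intro bij_betw_subset[OF bij_betw_hmap]) auto
  then show "card ?A = card ?B" by (rule bij_betw_same_card)
qed

end
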